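(* Let $X,Y,Z$ be connected amenable graphs of bounded degree, let $\kappa_1,\kappa_2>0$, let $f:X\to Y$ be a quasi-$\kappa_1$-to-one quasi-isometry and let $g:Y\to Z$ be a quasi-$\kappa_2$-to-one quasi-isometry. Then $g\circ f:X\to Z$ is a quasi-$\kappa_1\kappa_2$-to-one quasi-isometry.
   Context: Graphs are identified with their vertex sets, equipped with the graph (path) metric. For a set $A$ of vertices, $\partial A$ denotes the set of vertices not in $A$ that are adjacent to a vertex of $A$. A bounded degree graph is amenable if it admits a sequence of non-empty finite vertex sets $A_n$ with $|\partial A_n|/|A_n|\to 0$. A map $f:X\to Y$ between metric spaces is a quasi-isometry if there are $C\geq 1$, $K\geq 0$ with $\frac1C d(x,y)-K\leq d(f(x),f(y))\leq C d(x,y)+K$ for all $x,y\in X$ and every point of $Y$ is within distance $K$ of $f(X)$. For $\kappa>0$, a map $f:X\to Y$ between bounded degree graphs is quasi-$\kappa$-to-one if there is a constant $C>0$ such that $\big|\kappa|A|-|f^{-1}(A)|\big|\leq C|\partial A|$ for all finite $A\subset Y$. A quasi-isometry is measure-scaling with scaling factor $\kappa$ if it is quasi-$\kappa$-to-one. *)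

theory Defs
  imports "HOL-Analysis.Analysis" "Graph_Theory.Digraph_Component"
begin

text \<open>
  A simple undirected, possibly infinite graph is a \<^locale>\<open>pair_bidirected_digraph\<close>: every edge is
  represented by its two orientations, and there are no loops. Nonempty connectedness is
  \<^const>\<open>Digraph_Component.connected\<close>, not the topological notion of the same base name.
\<close>

definition bounded_degree :: "'a pair_pre_digraph \<Rightarrow> bool" where
  "bounded_degree G \<longleftrightarrow>
     (\<exists>D. \<forall>v\<in>pverts G. finite (out_arcs (with_proj G) v) \<and> out_degree (with_proj G) v \<le> D)"

definition vertex_boundary :: "'a pair_pre_digraph \<Rightarrow> 'a set \<Rightarrow> 'a set" where
  "vertex_boundary G A = {v \<in> pverts G. v \<notin> A \<and> (\<exists>u\<in>A. (u, v) \<in> parcs G)}"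

definition amenable :: "'a pair_pre_digraph \<Rightarrow> bool" where
  "amenable G \<longleftrightarrow>
     (\<exists>A :: nat \<Rightarrow> 'a set.
        (\<forall>n. A n \<noteq> {} \<and> finite (A n) \<and> A n \<subseteq> pverts G) \<and>
        (\<lambda>n. real (card (vertex_boundary G (A n))) / real (card (A n))) \<longlonglongrightarrow> 0)"

text \<open>
  Walks are lists of arcs, so the length of the list is the number of edges traversed. The value
  of the distance is meaningful only for vertices joined by a walk.
\<close>

definition graph_dist :: "'a pair_pre_digraph \<Rightarrow> 'a \<Rightarrow> 'a \<Rightarrow> nat" where
  "graph_dist G u v = (LEAST n. \<exists>p. pre_digraph.awalk (with_proj G) u p v \<and> length p = n)"

definition path_metric :: "'a pair_pre_digraph \<Rightarrow> 'a metric" where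
  "path_metric G = metric (pverts G, \<lambda>u v. real (graph_dist G u v))"

lemma connected_awalk:
  assumes "pair_bidirected_digraph G" "Digraph_Component.connected G" 
    and "u \<in> pverts G" "v \<in> pverts G"
  shows "\<exists>p. pre_digraph.awalk (with_proj G) u p v"
proof -
  interpret pair_bidirected_digraph G by fact
  have "u \<rightarrow>\<^sup>*\<^bsub>mk_symmetric (with_proj G)\<^esub> v"
    using assms(2-4) by (auto simp: Digraph_Component.connected_def strongly_connected_def)
  then have "u \<rightarrow>\<^sup>*\<^bsub>with_proj G\<^esub> v"
    using reachable_mk_symmetric_eq[OF pair_sym_arcs] by simp
  then show ?thesis by (simp add: reachable_awalk)
qed

lemma graph_dist_walk:
  assumes "pre_digraph.awalk (with_proj G) u q v"
  shows "\<exists>p. pre_digraph.awalk (with_proj G) u p v \<and> length p = graph_dist G u v"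
  unfolding graph_dist_def by (rule LeastI_ex) (use assms in blast)

lemma graph_dist_le:
  assumes "pre_digraph.awalk (with_proj G) u p v"
  shows "graph_dist G u v \<le> length p"
  unfolding graph_dist_def by (rule Least_le) (use assms in blast)

lemma awalk_reverse:
  assumes "pair_bidirected_digraph G" "pre_digraph.awalk (with_proj G) u p v"
  shows "\<exists>q. pre_digraph.awalk (with_proj G) v q u \<and> length q = length p"
proof -
  interpret pair_bidirected_digraph G by fact
  have symG: "(b, a) \<in> parcs G" if "(a, b) \<in> parcs G" for a b
    using pair_sym_arcs that by (simp add: symmetric_def sym_def)
  show ?thesis using assms(2)
  proof (induction p arbitrary: u)
    case Nil
    then show ?case by (auto simp: awalk_Nil_iff intro!: exI[of _ "[]"])
  next
    case (Cons e p)
    then have e: "e \<in> parcs G" "u = fst e" and w: "awalk (snd e) p v"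
      by (auto simp: awalk_Cons_iff)
    from Cons.IH[OF w] obtain q where q: "awalk v q (snd e)" "length q = length p" by blast
    have s: "(snd e, fst e) \<in> parcs G" using symG e by auto
    then have "awalk (snd e) [(snd e, fst e)] u"
      using e arc_snd_in_verts[OF s] by (simp add: awalk_Cons_iff awalk_Nil_iff)
    then have "awalk v (q @ [(snd e, fst e)]) u" using awalk_appendI[OF q(1)] by blast
    then show ?case using q(2) by (intro exI[of _ "q @ [(snd e, fst e)]"]) auto
  qed
qed

lemma Metric_space_graph_dist:
  assumes G: "pair_bidirected_digraph G" and conn: "Digraph_Component.connected G"
  shows "Metric_space (pverts G) (\<lambda>u v. real (graph_dist G u v))"
proof -
  interpret pair_bidirected_digraph G by fact
  have walk: "\<exists>p. awalk u p v \<and> length p = graph_dist G u v"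
    if "u \<in> pverts G" "v \<in> pverts G" for u v
      proof -
    obtain p where "awalk u p v" using connected_awalk[OF G conn \<open>u \<in> _\<close> \<open>v \<in> _\<close>] ..
    then show ?thesis by (rule graph_dist_walk)
  qed
  have le: "graph_dist G v u \<le> graph_dist G u v" if uv: "u \<in> pverts G" "v \<in> pverts G" for u v
  proof -
    obtain p where p: "awalk u p v" "length p = graph_dist G u v" using walk[OF uv] by blast
    obtain q where "awalk v q u" "length q = length p" using awalk_reverse[OF G p(1)] by blast
    with p(2) show ?thesis using graph_dist_le by metis
  qed
  have 0: "graph_dist G x y = 0 \<longleftrightarrow> x = y" if "x \<in> pverts G" "y \<in> pverts G" for x y
  proof
    assume "graph_dist G x y = 0"
    then have "awalk x [] y" using walk[OF that] by (metis length_0_conv)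
    then show "x = y" by (simp add: awalk_Nil_iff)
  next
    assume "x = y"
    then have "awalk x [] y" using that by (simp add: awalk_Nil_iff)
    from graph_dist_le[OF this] show "graph_dist G x y = 0" by simp
  qed
  have tri: "graph_dist G x z \<le> graph_dist G x y + graph_dist G y z"
    if v: "x \<in> pverts G" "y \<in> pverts G" "z \<in> pverts G" for x y z
  proof -
    obtain p q where "awalk x p y" "length p = graph_dist G x y"
      "awalk y q z" "length q = graph_dist G y z"
      using walk[OF v(1,2)] walk[OF v(2,3)] by blast
    then have "awalk x (p @ q) z" "length (p @ q) = graph_dist G x y + graph_dist G y z"
      by (auto intro: awalk_appendI)
    then show ?thesis using graph_dist_le by metis
  qed
  show ?thesis
  proof
    show "real (graph_dist G x y) = real (graph_dist G y x)" for x y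
    proof (cases "x \<in> pverts G \<and> y \<in> pverts G")
      case True
      then show ?thesis using le by (simp add: order_antisym)
    next
      case False
      have none: "\<not> awalk a p b" if "a \<notin> pverts G \<or> b \<notin> pverts G" for a b p
        by (meson that awalk_hd_in_verts awalk_last_in_verts)
      then show ?thesis using False by (auto simp: graph_dist_def)
    qed
    show "real (graph_dist G x z) \<le> real (graph_dist G x y) + real (graph_dist G y z)"
      if "x \<in> pverts G" "y \<in> pverts G" "z \<in> pverts G" for x y z
      using tri[OF that] by linarith
  qed (use 0 in auto)
qed

lemma path_metric_simps:
  assumes "pair_bidirected_digraph G" "Digraph_Component.connected G"
  shows "mspace (path_metric G) = pverts G"
    and "mdist (path_metric G) = (\<lambda>u v. real (graph_dist G u v))"
  using Metric_space_graph_dist[OF assms]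
  by (simp_all add: path_metric_def Metric_space.mspace_metric Metric_space.mdist_metric)

definition quasi_isometry :: "'a metric \<Rightarrow> 'b metric \<Rightarrow> ('a \<Rightarrow> 'b) \<Rightarrow> bool" where
  "quasi_isometry M N f \<longleftrightarrow>
     f ` mspace M \<subseteq> mspace N \<and>
     (\<exists>C\<ge>1. \<exists>K\<ge>0.
        (\<forall>x\<in>mspace M. \<forall>y\<in>mspace M.
           1 / C * mdist M x y - K \<le> mdist N (f x) (f y) \<and>
           mdist N (f x) (f y) \<le> C * mdist M x y + K) \<and>
        (\<forall>z\<in>mspace N. \<exists>x\<in>mspace M. mdist N z (f x) \<le> K))"

text \<open>
  Finiteness of the preimage is part of the inequality: an infinite preimage would make the
  left-hand side infinite, whereas \<^const>\<open>card\<close> of an infinite set is 0.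
\<close>

definition quasi_to_one ::
    "real \<Rightarrow> 'a pair_pre_digraph \<Rightarrow> 'b pair_pre_digraph \<Rightarrow> ('a \<Rightarrow> 'b) \<Rightarrow> bool" where
  "quasi_to_one \<kappa> X Y f \<longleftrightarrow>
     f ` pverts X \<subseteq> pverts Y \<and>
     (\<exists>C>0. \<forall>A. finite A \<and> A \<subseteq> pverts Y \<longrightarrow>
        finite (f -` A \<inter> pverts X) \<and>
        \<bar>\<kappa> * real (card A) - real (card (f -` A \<inter> pverts X))\<bar>
          \<le> C * real (card (vertex_boundary Y A)))"

end

theory Submission
  imports Defs
begin

text \<open>
  For a finite set \<open>A\<close> of vertices of \<open>Z\<close>, put \<open>B = g\<inverse>(A)\<close>. The triangle inequality gives
  \<open>|\<kappa>\<^sub>1 \<kappa>\<^sub>2 |A| - |f\<inverse>(B)||  \<le>  \<kappa>\<^sub>1 |\<kappa>\<^sub>2 |A| - |B|| + |\<kappa>\<^sub>1 |B| - |f\<inverse>(B)||\<close>,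
  which is at most \<open>\<kappa>\<^sub>1 C\<^sub>2 |\<partial>A| + C\<^sub>1 |\<partial>B|\<close> for the constants \<open>C\<^sub>1\<close>, \<open>C\<^sub>2\<close> of \<open>f\<close> and \<open>g\<close>,
  so everything reduces to bounding \<open>|\<partial>B|\<close> by a multiple of \<open>|\<partial>A|\<close>
  (lemma \<open>card_boundary_preimage_le\<close>). This is where the geometry of \<open>g\<close> enters. A vertex \<open>v\<close> of
  \<open>\<partial>B\<close> has a neighbour \<open>u\<close> in \<open>B\<close>; the images \<open>g u \<in> A\<close> and \<open>g v \<notin> A\<close> are joined by a walk of
  length bounded by a constant, and that walk has to pass through \<open>\<partial>A\<close> (lemma
  \<open>awalk_crosses_boundary\<close>). So \<open>g v\<close> lies within a fixed distance of some \<open>w \<in> \<partial>A\<close>. For each \<open>w\<close>,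
  the vertices \<open>v\<close> that arise in this way are a bounded distance apart, because \<open>g\<close> does not
  contract large distances too much, and bounded degree bounds their number
  (lemma \<open>card_preimage_ball_le\<close>).
\<close>

section \<open>Composition of quasi-isometries\<close>

lemma quasi_isometry_compose:
  assumes "quasi_isometry M N f" "quasi_isometry N P g"
  shows "quasi_isometry M P (g \<circ> f)"
proof -
  from assms(1) obtain C K where f: "f ` mspace M \<subseteq> mspace N" and C: "C \<ge> 1" and K: "K \<ge> 0"
    and f_low: "\<And>x y. x \<in> mspace M \<Longrightarrow> y \<in> mspace M \<Longrightarrow> 1 / C * mdist M x y - K \<le> mdist N (f x) (f y)"
    and f_up: "\<And>x y. x \<in> mspace M \<Longrightarrow> y \<in> mspace M \<Longrightarrow> mdist N (f x) (f y) \<le> C * mdist M x y + K"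
    and f_dense: "\<And>z. z \<in> mspace N \<Longrightarrow> \<exists>x\<in>mspace M. mdist N z (f x) \<le> K"
    unfolding quasi_isometry_def by blast
  from assms(2) obtain C' K' where g: "g ` mspace N \<subseteq> mspace P" and C': "C' \<ge> 1" and K': "K' \<ge> 0"
    and g_low: "\<And>x y. x \<in> mspace N \<Longrightarrow> y \<in> mspace N \<Longrightarrow> 1 / C' * mdist N x y - K' \<le> mdist P (g x) (g y)"
    and g_up: "\<And>x y. x \<in> mspace N \<Longrightarrow> y \<in> mspace N \<Longrightarrow> mdist P (g x) (g y) \<le> C' * mdist N x y + K'"
    and g_dense: "\<And>z. z \<in> mspace P \<Longrightarrow> \<exists>x\<in>mspace N. mdist P z (g x) \<le> K'"
    unfolding quasi_isometry_def by blast
  \<comment> \<open>One copy of \<open>K'\<close> is the additive error of \<open>g\<close>, the other its defect of surjectivity.\<close>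
  define L where "L = C' * K + 2 * K'"
  have K_le: "K \<le> C' * K" "1 / C' * K \<le> C' * K"
  proof -
    show "K \<le> C' * K" using mult_right_mono[OF C' K] by simp
    moreover have "1 / C' * K \<le> 1 * K" using C' K by (intro mult_right_mono) auto
    ultimately show "1 / C' * K \<le> C' * K" by linarith
  qed
  have low: "1 / (C * C') * mdist M x y - L \<le> mdist P (g (f x)) (g (f y))"
    if "x \<in> mspace M" "y \<in> mspace M" for x y
  proof -
    have "1 / C' * (1 / C * mdist M x y - K) \<le> 1 / C' * mdist N (f x) (f y)"
      using f_low[OF that] C' by (intro mult_left_mono) auto
    moreover have "1 / C' * mdist N (f x) (f y) - K' \<le> mdist P (g (f x)) (g (f y))"
      using g_low f that by blast
    moreover have "1 / C' * (1 / C * mdist M x y - K) = 1 / (C * C') * mdist M x y - 1 / C' * K"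
      by (simp add: algebra_simps)
    ultimately show ?thesis using K_le K' unfolding L_def by linarith
  qed
  have up: "mdist P (g (f x)) (g (f y)) \<le> (C * C') * mdist M x y + L"
    if "x \<in> mspace M" "y \<in> mspace M" for x y
  proof -
    have "C' * mdist N (f x) (f y) \<le> C' * (C * mdist M x y + K)"
      using f_up[OF that] C' by (intro mult_left_mono) auto
    moreover have "mdist P (g (f x)) (g (f y)) \<le> C' * mdist N (f x) (f y) + K'"
      using g_up f that by blast
    moreover have "C' * (C * mdist M x y + K) = C * C' * mdist M x y + C' * K"
      by (simp add: algebra_simps)
    ultimately show ?thesis using K' unfolding L_def by linarith
  qed
  have dense: "\<exists>x\<in>mspace M. mdist P z (g (f x)) \<le> L" if z: "z \<in> mspace P" for z
  proof -
    obtain y where y: "y \<in> mspace N" "mdist P z (g y) \<le> K'" using g_dense[OF z] by blast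
    obtain x where x: "x \<in> mspace M" "mdist N y (f x) \<le> K" using f_dense[OF y(1)] by blast
    have fx: "f x \<in> mspace N" using f x by blast
    have "mdist P z (g (f x)) \<le> mdist P z (g y) + mdist P (g y) (g (f x))"
      using z y(1) fx g by (intro mdist_triangle) auto
    also have "\<dots> \<le> K' + (C' * mdist N y (f x) + K')"
      using y g_up[OF y(1) fx] by linarith
    also have "\<dots> \<le> K' + (C' * K + K')"
      using mult_left_mono[OF x(2), of C'] C' by linarith
    finally show ?thesis using x(1) unfolding L_def by (intro bexI[of _ x]) auto
  qed
  have "1 \<le> C * C'" using mult_mono[OF C C'] C by simp
  moreover have "0 \<le> L" using K K' C' unfolding L_def by simp
  moreover have "(g \<circ> f) ` mspace M \<subseteq> mspace P" using f g by auto
  ultimately show ?thesis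
    unfolding quasi_isometry_def using low up dense
    by (intro conjI exI[of _ "C * C'"] exI[of _ L]) auto
qed

section \<open>Balls and boundaries in graphs of bounded degree\<close>

lemma out_neighbours_bounded:
  assumes "bounded_degree G"
  obtains D where "\<And>v. v \<in> pverts G \<Longrightarrow> finite {w. (v, w) \<in> parcs G} \<and> card {w. (v, w) \<in> parcs G} \<le> D"
proof -
  obtain D where D: "\<And>v. v \<in> pverts G \<Longrightarrow> finite (out_arcs (with_proj G) v) \<and> card (out_arcs (with_proj G) v) \<le> D"
    using assms unfolding bounded_degree_def out_degree_def by blast
  show thesis
  proof (rule that[of D])
    fix v assume v: "v \<in> pverts G"
    have "{w. (v, w) \<in> parcs G} = snd ` out_arcs (with_proj G) v"
      by (force simp: out_arcs_def)
    then show "finite {w. (v, w) \<in> parcs G} \<and> card {w. (v, w) \<in> parcs G} \<le> D"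
      using D[OF v] card_image_le[of "out_arcs (with_proj G) v" snd] by auto
  qed
qed

text \<open>
  A walk of length at most \<open>n + 1\<close> is either trivial or continues from one of at most \<open>D\<close>
  neighbours with a walk of length at most \<open>n\<close>; so the bound satisfies a recursion
  \<open>b (n + 1) = 1 + D * b n\<close> that does not involve the starting vertex.
\<close>

lemma card_awalk_ball_le:
  assumes G: "pair_bidirected_digraph G" and deg: "bounded_degree G"
  shows "\<exists>b. \<forall>v\<in>pverts G.
    finite {u. \<exists>p. pre_digraph.awalk (with_proj G) v p u \<and> length p \<le> n} \<and>
    card {u. \<exists>p. pre_digraph.awalk (with_proj G) v p u \<and> length p \<le> n} \<le> b"
proof -
  interpret pair_bidirected_digraph G by fact
  define S where "S n v = {u. \<exists>p. awalk v p u \<and> length p \<le> n}" for n v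
  obtain D where D: "\<And>v. v \<in> pverts G \<Longrightarrow> finite {w. (v, w) \<in> parcs G} \<and> card {w. (v, w) \<in> parcs G} \<le> D"
    using out_neighbours_bounded[OF deg] by blast
  have "\<exists>b. \<forall>v\<in>pverts G. finite (S n v) \<and> card (S n v) \<le> b"
  proof (induction n)
    case 0
    have "S 0 v \<subseteq> {v}" for v by (auto simp: S_def awalk_Nil_iff)
    then have "finite (S 0 v) \<and> card (S 0 v) \<le> 1" for v
      using card_mono[of "{v}" "S 0 v"] finite_subset[of "S 0 v" "{v}"] by auto
    then show ?case by blast
  next
    case (Suc n)
    then obtain b where b: "\<And>v. v \<in> pverts G \<Longrightarrow> finite (S n v) \<and> card (S n v) \<le> b" by blast
    have "finite (S (Suc n) v) \<and> card (S (Suc n) v) \<le> Suc (D * b)" if v: "v \<in> pverts G" for v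
    proof -
      define N where "N = {w. (v, w) \<in> parcs G}"
      have N: "finite N" "card N \<le> D" using D[OF v] unfolding N_def by auto
      have NV: "w \<in> pverts G" if "w \<in> N" for w
        using that arc_snd_in_verts unfolding N_def by force
      have sub: "S (Suc n) v \<subseteq> insert v (\<Union>w\<in>N. S n w)"
      proof
        fix u assume "u \<in> S (Suc n) v"
        then obtain p where p: "awalk v p u" "length p \<le> Suc n" unfolding S_def by blast
        show "u \<in> insert v (\<Union>w\<in>N. S n w)"
        proof (cases p)
          case Nil
          then show ?thesis using p by (simp add: awalk_Nil_iff)
        next
          case (Cons e q)
          then have "snd e \<in> N" "u \<in> S n (snd e)"
            using p by (auto simp: awalk_Cons_iff N_def S_def)
          then show ?thesis by blast
        qed
      qed
      have fin: "finite (\<Union>w\<in>N. S n w)" using N b NV by blast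
      have "card (\<Union>w\<in>N. S n w) \<le> (\<Sum>w\<in>N. card (S n w))" by (rule card_UN_le[OF N(1)])
      also have "\<dots> \<le> card N * b" using sum_bounded_above[of N "\<lambda>w. card (S n w)" b] b NV by simp
      also have "\<dots> \<le> D * b" using N by simp
      finally have "card (insert v (\<Union>w\<in>N. S n w)) \<le> Suc (D * b)"
        using fin by (simp add: card_insert_if)
      then show ?thesis
        using sub fin card_mono[OF _ sub] finite_subset[OF sub] by simp
    qed
    then show ?case by blast
  qed
  then show ?thesis unfolding S_def .
qed

lemma card_ball_le:
  assumes "pair_bidirected_digraph G" "Digraph_Component.connected G" "bounded_degree G"
  shows "\<exists>b. \<forall>v\<in>pverts G. finite {u \<in> pverts G. real (graph_dist G v u) \<le> r} \<and>
    card {u \<in> pverts G. real (graph_dist G v u) \<le> r} \<le> b"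
proof -
  define n where "n = nat \<lfloor>r\<rfloor>"
  obtain b where b: "\<forall>v\<in>pverts G.
      finite {u. \<exists>p. pre_digraph.awalk (with_proj G) v p u \<and> length p \<le> n} \<and>
      card {u. \<exists>p. pre_digraph.awalk (with_proj G) v p u \<and> length p \<le> n} \<le> b"
    using card_awalk_ball_le[OF assms(1,3)] by blast
  have "{u \<in> pverts G. real (graph_dist G v u) \<le> r}
      \<subseteq> {u. \<exists>p. pre_digraph.awalk (with_proj G) v p u \<and> length p \<le> n}" if v: "v \<in> pverts G" for v
  proof clarify
    fix u assume u: "u \<in> pverts G" "real (graph_dist G v u) \<le> r"
    then have "graph_dist G v u \<le> n" unfolding n_def by (simp add: le_nat_floor)
    moreover obtain p where "pre_digraph.awalk (with_proj G) v p u \<and> length p = graph_dist G v u"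
      using connected_awalk[OF assms(1,2) v u(1)] graph_dist_walk by metis
    ultimately show "\<exists>p. pre_digraph.awalk (with_proj G) v p u \<and> length p \<le> n" by auto
  qed
  then show ?thesis using b by (meson card_mono finite_subset order_trans)
qed

lemma finite_vertex_boundary:
  assumes "bounded_degree G" "finite A" "A \<subseteq> pverts G"
  shows "finite (vertex_boundary G A)"
proof -
  obtain D where D: "\<And>v. v \<in> pverts G \<Longrightarrow> finite {w. (v, w) \<in> parcs G} \<and> card {w. (v, w) \<in> parcs G} \<le> D"
    using out_neighbours_bounded[OF assms(1)] by blast
  have "vertex_boundary G A \<subseteq> (\<Union>u\<in>A. {w. (u, w) \<in> parcs G})"
    unfolding vertex_boundary_def by blast
  moreover have "finite (\<Union>u\<in>A. {w. (u, w) \<in> parcs G})" using assms D by blast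
  ultimately show ?thesis by (rule finite_subset)
qed

text \<open>
  Follow the walk until it first leaves \<open>A\<close>: the vertex reached there lies in the boundary, and
  what is left of the walk leads from it to \<open>v\<close>.
\<close>

lemma awalk_crosses_boundary:
  assumes G: "pair_bidirected_digraph G"
    and "pre_digraph.awalk (with_proj G) u p v" "u \<in> A" "v \<notin> A"
  shows "\<exists>w\<in>vertex_boundary G A. \<exists>q. pre_digraph.awalk (with_proj G) w q v \<and> length q \<le> length p"
proof -
  interpret pair_bidirected_digraph G by fact
  show ?thesis using assms(2,3)
  proof (induction p arbitrary: u)
    case Nil
    then show ?case using \<open>v \<notin> A\<close> by (simp add: awalk_Nil_iff)
  next
    case (Cons e p)
    then have e: "e \<in> parcs G" "u = fst e" and w: "awalk (snd e) p v"
      by (auto simp: awalk_Cons_iff)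
    show ?case
    proof (cases "snd e \<in> A")
      case True
      from Cons.IH[OF w this] obtain w q where
          "w \<in> vertex_boundary G A" "awalk w q v" "length q \<le> length p" by blast
      then show ?thesis by (intro bexI[of _ w] exI[of _ q]) auto
    next
      case False
      moreover have "(u, snd e) \<in> parcs G" "snd e \<in> pverts G"
        using e arc_snd_in_verts by auto
      ultimately have "snd e \<in> vertex_boundary G A"
        using Cons.prems unfolding vertex_boundary_def by blast
      then show ?thesis using w by (intro bexI[of _ "snd e"] exI[of _ p]) auto
    qed
  qed
qed

section \<open>Preimages under quasi-isometries\<close>

text \<open>
  Two points of such a preimage have images at distance at most \<open>2 * r\<close>, so they are themselves
  at distance at most \<open>C * (2 * r + K)\<close>, where \<open>C\<close> and \<open>K\<close> are constants for \<open>g\<close>; the preimage lies in a ball of this radius around any of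
  its points.
\<close>

lemma card_preimage_ball_le:
  assumes Y: "pair_bidirected_digraph Y" "Digraph_Component.connected Y" "bounded_degree Y"
    and Z: "pair_bidirected_digraph Z" "Digraph_Component.connected Z"
    and g: "quasi_isometry (path_metric Y) (path_metric Z) g"
  shows "\<exists>b. \<forall>w\<in>pverts Z. finite {v \<in> pverts Y. real (graph_dist Z w (g v)) \<le> r} \<and>
    card {v \<in> pverts Y. real (graph_dist Z w (g v)) \<le> r} \<le> b"
proof -
  from g obtain C K where gYZ: "g ` pverts Y \<subseteq> pverts Z" and C: "C \<ge> 1"
    and low: "\<And>x y. x \<in> pverts Y \<Longrightarrow> y \<in> pverts Y \<Longrightarrow>
        1 / C * real (graph_dist Y x y) - K \<le> real (graph_dist Z (g x) (g y))"
    unfolding quasi_isometry_def path_metric_simps[OF Y(1,2)] path_metric_simps[OF Z] by blast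
  interpret Z: Metric_space "pverts Z" "\<lambda>u v. real (graph_dist Z u v)"
    by (rule Metric_space_graph_dist[OF Z])
  obtain b where b: "\<forall>v\<in>pverts Y. finite {u \<in> pverts Y. real (graph_dist Y v u) \<le> C * (2 * r + K)} \<and>
      card {u \<in> pverts Y. real (graph_dist Y v u) \<le> C * (2 * r + K)} \<le> b"
    using card_ball_le[OF Y] by blast
  have "finite {v \<in> pverts Y. real (graph_dist Z w (g v)) \<le> r} \<and>
      card {v \<in> pverts Y. real (graph_dist Z w (g v)) \<le> r} \<le> b" (is "finite ?F \<and> _")
    if w: "w \<in> pverts Z" for w
  proof (cases "?F = {}")
    case True
    show ?thesis unfolding True by simp
  next
    case False
    then obtain a where a: "a \<in> pverts Y" "real (graph_dist Z w (g a)) \<le> r" by blast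
    have sub: "?F \<subseteq> {u \<in> pverts Y. real (graph_dist Y a u) \<le> C * (2 * r + K)}"
    proof clarify
      fix u assume u: "u \<in> pverts Y" "real (graph_dist Z w (g u)) \<le> r"
      have "real (graph_dist Z (g a) (g u)) \<le> real (graph_dist Z (g a) w) + real (graph_dist Z w (g u))"
        using a(1) u(1) w gYZ by (intro Z.triangle) auto
      then have "real (graph_dist Z (g a) (g u)) \<le> 2 * r"
        using a(2) u(2) Z.commute[of w "g a"] by linarith
      then have "1 / C * real (graph_dist Y a u) \<le> 2 * r + K"
        using low[OF a(1) u(1)] by linarith
      then show "real (graph_dist Y a u) \<le> C * (2 * r + K)"
        using C by (simp add: field_simps)
    qed
    show ?thesis
      using b a(1) card_mono[OF _ sub] finite_subset[OF sub] by (meson order_trans)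
  qed
  then show ?thesis by blast
qed

lemma card_boundary_preimage_le:
  assumes Y: "pair_bidirected_digraph Y" "Digraph_Component.connected Y" "bounded_degree Y"
    and Z: "pair_bidirected_digraph Z" "Digraph_Component.connected Z" "bounded_degree Z"
    and g: "quasi_isometry (path_metric Y) (path_metric Z) g"
  shows "\<exists>b. \<forall>A. finite A \<and> A \<subseteq> pverts Z \<longrightarrow>
    card (vertex_boundary Y (g -` A \<inter> pverts Y)) \<le> b * card (vertex_boundary Z A)"
proof -
  from g obtain C K where gYZ: "g ` pverts Y \<subseteq> pverts Z" and C: "C \<ge> 1"
    and up: "\<And>x y. x \<in> pverts Y \<Longrightarrow> y \<in> pverts Y \<Longrightarrow>
        real (graph_dist Z (g x) (g y)) \<le> C * real (graph_dist Y x y) + K"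
    unfolding quasi_isometry_def path_metric_simps[OF Y(1,2)] path_metric_simps[OF Z(1,2)] by blast
  obtain b where b: "\<forall>w\<in>pverts Z. finite {v \<in> pverts Y. real (graph_dist Z w (g v)) \<le> C + K} \<and>
      card {v \<in> pverts Y. real (graph_dist Z w (g v)) \<le> C + K} \<le> b"
    using card_preimage_ball_le[OF Y Z(1,2) g] by blast
  define F where "F w = {v \<in> pverts Y. real (graph_dist Z w (g v)) \<le> C + K}" for w
  have "card (vertex_boundary Y (g -` A \<inter> pverts Y)) \<le> b * card (vertex_boundary Z A)"
    if A: "finite A" "A \<subseteq> pverts Z" for A
  proof -
    have fin: "finite (vertex_boundary Z A)" by (rule finite_vertex_boundary[OF Z(3) A])
    have bV: "w \<in> pverts Z" if "w \<in> vertex_boundary Z A" for w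
      using that unfolding vertex_boundary_def by blast
    have sub: "vertex_boundary Y (g -` A \<inter> pverts Y) \<subseteq> (\<Union>w\<in>vertex_boundary Z A. F w)"
    proof
      fix v assume "v \<in> vertex_boundary Y (g -` A \<inter> pverts Y)"
      then obtain u where v: "v \<in> pverts Y" "g v \<notin> A" and u: "u \<in> pverts Y" "g u \<in> A"
        and uv: "(u, v) \<in> parcs Y"
        unfolding vertex_boundary_def by blast
      interpret Y: pair_bidirected_digraph Y by (rule Y(1))
      have "Y.awalk u [(u, v)] v" using uv v u by (simp add: Y.awalk_Cons_iff Y.awalk_Nil_iff)
      from graph_dist_le[OF this] have "real (graph_dist Y u v) \<le> 1" by simp
      then have "C * real (graph_dist Y u v) \<le> C" using C by (simp add: mult_left_le)
      then have near: "real (graph_dist Z (g u) (g v)) \<le> C + K"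
        using up[OF u(1) v(1)] by linarith
      obtain p' where "pre_digraph.awalk (with_proj Z) (g u) p' (g v)"
        using connected_awalk[OF Z(1,2), of "g u" "g v"] gYZ u(1) v(1) by auto
      from graph_dist_walk[OF this] obtain p where
          p: "pre_digraph.awalk (with_proj Z) (g u) p (g v)" "length p = graph_dist Z (g u) (g v)"
        by blast
      obtain w q where w: "w \<in> vertex_boundary Z A" "pre_digraph.awalk (with_proj Z) w q (g v)"
          "length q \<le> length p"
        using awalk_crosses_boundary[OF Z(1) p(1) u(2) v(2)] by blast
      have "real (graph_dist Z w (g v)) \<le> C + K"
        using graph_dist_le[OF w(2)] w(3) p(2) near by linarith
      then show "v \<in> (\<Union>w\<in>vertex_boundary Z A. F w)" using w(1) v(1) unfolding F_def by blast
    qed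
    have "card (vertex_boundary Y (g -` A \<inter> pverts Y)) \<le> card (\<Union>w\<in>vertex_boundary Z A. F w)"
      using fin b bV unfolding F_def by (intro card_mono[OF _ sub[unfolded F_def]]) blast
    also have "\<dots> \<le> (\<Sum>w\<in>vertex_boundary Z A. card (F w))" by (rule card_UN_le[OF fin])
    also have "\<dots> \<le> card (vertex_boundary Z A) * b"
      using sum_bounded_above[of "vertex_boundary Z A" "\<lambda>w. card (F w)" b] b bV
      unfolding F_def by simp
    finally show ?thesis by (simp add: mult.commute)
  qed
  then show ?thesis by (intro exI[of _ b] allI impI) simp
qed

section \<open>Composition of quasi-to-one maps\<close>

text \<open>
  Counting the preimage in two stages costs an error of order \<open>|\<partial>B|\<close> with \<open>B = g\<inverse>(A)\<close> in the
  stage of \<open>f\<close>; the hypothesis on boundaries converts it into one of order \<open>|\<partial>A|\<close>.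
\<close>

lemma quasi_to_one_compose:
  assumes f: "quasi_to_one \<kappa> X Y f" and g: "quasi_to_one \<mu> Y Z g" and \<kappa>: "\<kappa> \<ge> 0"
    and boundary: "\<And>A. finite A \<Longrightarrow> A \<subseteq> pverts Z \<Longrightarrow>
        card (vertex_boundary Y (g -` A \<inter> pverts Y)) \<le> b * card (vertex_boundary Z A)"
  shows "quasi_to_one (\<kappa> * \<mu>) X Z (g \<circ> f)"
proof -
  have fXY: "f ` pverts X \<subseteq> pverts Y" and gYZ: "g ` pverts Y \<subseteq> pverts Z"
    using f g unfolding quasi_to_one_def by simp_all
  from f obtain C where C: "C > 0" and f_count: "\<forall>B. finite B \<and> B \<subseteq> pverts Y \<longrightarrow>
      finite (f -` B \<inter> pverts X) \<and>
      \<bar>\<kappa> * real (card B) - real (card (f -` B \<inter> pverts X))\<bar> \<le> C * real (card (vertex_boundary Y B))"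
    unfolding quasi_to_one_def by (elim conjE exE)
  from g obtain C' where C': "C' > 0" and g_count: "\<forall>A. finite A \<and> A \<subseteq> pverts Z \<longrightarrow>
      finite (g -` A \<inter> pverts Y) \<and>
      \<bar>\<mu> * real (card A) - real (card (g -` A \<inter> pverts Y))\<bar> \<le> C' * real (card (vertex_boundary Z A))"
    unfolding quasi_to_one_def by (elim conjE exE)
  \<comment> \<open>The summand 1 keeps the constant positive when \<open>\<kappa>\<close> and \<open>b\<close> vanish.\<close>
  define L where "L = \<kappa> * C' + C * real b + 1"
  have main: "finite ((g \<circ> f) -` A \<inter> pverts X) \<and>
      \<bar>\<kappa> * \<mu> * real (card A) - real (card ((g \<circ> f) -` A \<inter> pverts X))\<bar>
        \<le> L * real (card (vertex_boundary Z A))" if A: "finite A" "A \<subseteq> pverts Z" for A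
  proof -
    define B where "B = g -` A \<inter> pverts Y"
    define d where "d = real (card (vertex_boundary Z A))"
    have B: "finite B" "B \<subseteq> pverts Y" using g_count A unfolding B_def by auto
    have pre: "(g \<circ> f) -` A \<inter> pverts X = f -` B \<inter> pverts X" using fXY unfolding B_def by auto
    have inner: "\<bar>\<kappa> * real (card B) - real (card (f -` B \<inter> pverts X))\<bar> \<le> C * real b * d"
    proof -
      have "real (card (vertex_boundary Y B)) \<le> real b * d"
        using boundary[OF A] unfolding B_def d_def by (metis of_nat_le_iff of_nat_mult)
      then have "C * real (card (vertex_boundary Y B)) \<le> C * (real b * d)"
        using C by (intro mult_left_mono) auto
      then show ?thesis using f_count[rule_format, of B] B by (simp add: mult.assoc)
    qed
    have outer: "\<bar>\<kappa> * \<mu> * real (card A) - \<kappa> * real (card B)\<bar> \<le> \<kappa> * C' * d"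
    proof -
      have "\<bar>\<kappa> * \<mu> * real (card A) - \<kappa> * real (card B)\<bar> = \<kappa> * \<bar>\<mu> * real (card A) - real (card B)\<bar>"
        using \<kappa> by (simp add: abs_mult_pos' right_diff_distrib mult.assoc)
      also have "\<dots> \<le> \<kappa> * (C' * d)"
        using g_count[rule_format, of A] A \<kappa> unfolding B_def d_def by (intro mult_left_mono) auto
      finally show ?thesis by (simp add: mult.assoc)
    qed
    have "L * d = \<kappa> * C' * d + C * real b * d + d" unfolding L_def by (simp add: algebra_simps)
    moreover have "d \<ge> 0" unfolding d_def by simp
    ultimately have "\<bar>\<kappa> * \<mu> * real (card A) - real (card (f -` B \<inter> pverts X))\<bar> \<le> L * d"
      using inner outer by linarith
    then show ?thesis using f_count[rule_format, of B] B unfolding pre d_def by simp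
  qed
  have "(g \<circ> f) ` pverts X \<subseteq> pverts Z" using fXY gYZ by auto
  moreover have "L > 0" unfolding L_def using \<kappa> C C' by (simp add: add_nonneg_pos)
  ultimately show ?thesis unfolding quasi_to_one_def using main by blast
qed

theorem proposition1p3:
  fixes X :: "'a pair_pre_digraph" and Y :: "'b pair_pre_digraph" and Z :: "'c pair_pre_digraph"
    and f :: "'a \<Rightarrow> 'b" and g :: "'b \<Rightarrow> 'c" and \<kappa>\<^sub>1 \<kappa>\<^sub>2 :: real
  assumes "pair_bidirected_digraph X" "Digraph_Component.connected X"
      "bounded_degree X" "amenable X"
    and "pair_bidirected_digraph Y" "Digraph_Component.connected Y"
      "bounded_degree Y" "amenable Y"
    and "pair_bidirected_digraph Z" "Digraph_Component.connected Z"
      "bounded_degree Z" "amenable Z"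
    and "\<kappa>\<^sub>1 > 0" "\<kappa>\<^sub>2 > 0"
    and "quasi_isometry (path_metric X) (path_metric Y) f" "quasi_to_one \<kappa>\<^sub>1 X Y f"
    and "quasi_isometry (path_metric Y) (path_metric Z) g" "quasi_to_one \<kappa>\<^sub>2 Y Z g"
  shows "quasi_isometry (path_metric X) (path_metric Z) (g \<circ> f) \<and>
    quasi_to_one (\<kappa>\<^sub>1 * \<kappa>\<^sub>2) X Z (g \<circ> f)"
proof
  show "quasi_isometry (path_metric X) (path_metric Z) (g \<circ> f)"
    by (rule quasi_isometry_compose[OF assms(15,17)])
next
  obtain b where "\<forall>A. finite A \<and> A \<subseteq> pverts Z \<longrightarrow>
      card (vertex_boundary Y (g -` A \<inter> pverts Y)) \<le> b * card (vertex_boundary Z A)"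
    using card_boundary_preimage_le[OF assms(5-7,9-11,17)] ..
  then show "quasi_to_one (\<kappa>\<^sub>1 * \<kappa>\<^sub>2) X Z (g \<circ> f)"
    using \<open>\<kappa>\<^sub>1 > 0\<close> by (intro quasi_to_one_compose[OF assms(16,18), where b = b]) simp_all
qed

end
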